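(* Let $\rho\in[-1,0)\cup(0,+\infty)$ be fixed and let $\{y(t),p_0(t),p(t)\mid t=1,\dots,T\}$ be time series with $y(t)\ge0$, $p_0(t)>0$, $p(t)=(p_1(t),p_2(t))>0$. Let $\lambda=(\lambda(1),\dots,\lambda(T))\in S_T$ be the permutation such that $$y(\lambda(T))<\cdots<y(\lambda(1)).$$ If $Sn(\lambda)$ does not belong to the closed bounded region bounded by $Sn(\mathrm{id}_{S_T})$ and $Sn(\Sigma_\rho)$, then the moment problem $$\int_{\mathbb R^2_+}\theta\Bigl(p_0(t)-\bigl(p_1(t)^{-\rho}x_1^{-\rho}+p_2(t)^{-\rho}x_2^{-\rho}\bigr)^{-\frac1\rho}\Bigr)\mu(dx)=y(t)\qquad(t=1,\dots,T)$$ is not solvable in the class of non-negative absolutely continuous measures $\mu(dx)$.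
   Context: $\theta(s)=1$ for $s\ge0$ and $\theta(s)=0$ for $s<0$. Put $\widehat p_i(t)=p_i(t)/p_0(t)$, $i=1,2$. For $\rho\in[-1,0)$ put $\widetilde p_i(t,\rho)=\widehat p_i(t)^{-\rho}$. For $\rho\in(0,+\infty)$ put $\widetilde p_i(t,\rho)=\tfrac1\varepsilon-\widehat p_i(t)^{-\rho}$, where $\varepsilon>0$ is fixed so small that $\widehat p_1(t)^{-\rho}<\tfrac1\varepsilon$, $\widehat p_2(t)^{-\rho}<\tfrac1\varepsilon$ for all $t$, and $\bigl(\widehat p_1(t)^{-\rho}x_1^{-\rho}+\widehat p_2(t)^{-\rho}x_2^{-\rho}\bigr)^{-1/\rho}>1$ for all $t$ whenever $x_1^{-\rho}+x_2^{-\rho}\le\varepsilon$. Numbering and $\Sigma_\rho$: the indices are numbered so that $\widetilde p_1(1,\rho)<\dots<\widetilde p_1(T,\rho)$, and $\Sigma_\rho=(\Sigma_\rho(1),\dots,\Sigma_\rho(T))\in S_T$ is the permutation with $\widetilde p_2(\Sigma_\rho(1),\rho)<\dots<\widetilde p_2(\Sigma_\rho(T),\rho)$ (all these values are assumed distinct). Standing assumptions of the section: no three of the lines $\widetilde p_1(t,\rho)z_1+\widetilde p_2(t,\rho)z_2=1$, $t=1,\dots,T$, have a common point in $\mathbb R^2_+$, and each ray $\{(z_1,z_2)\in\mathbb R^2_+\mid z_2=z_1\tan\alpha\}$, $\alpha\in(0,\tfrac\pi2)$, meets at most one intersection point of these lines. Fix $\xi_j=(j-\lfloor T/2\rfloor,1)\in\mathbb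 R^2$, $j=1,\dots,T$. For a permutation $\lambda\in S_T$ the snake $Sn(\lambda)$ is the polygonal chain $\overline{V_1(\lambda)\cdots V_{T+1}(\lambda)}$ with $V_k(\lambda)=\xi_{\lambda(k)}+\xi_{\lambda(k+1)}+\cdots+\xi_{\lambda(T)}$ for $k=1,\dots,T$ and $V_{T+1}(\lambda)=0$. $\mathrm{id}_{S_T}=(1,\dots,T)$. The closed bounded region bounded by two snakes (which share their endpoints) is the union of the two snakes and the bounded connected components of the complement of their union in $\mathbb R^2$. *)

theory Defs
  imports "HOL-Analysis.Analysis" "HOL-Combinatorics.Permutations"
begin

definition nonneg_quadrant :: "(real \<times> real) set" where
  "nonneg_quadrant = {z. 0 \<le> fst z \<and> 0 \<le> snd z}"

definition theta :: "real \<Rightarrow> real" where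
  "theta s = (if 0 \<le> s then 1 else 0)"

definition p_hat :: "(nat \<Rightarrow> real) \<Rightarrow> (nat \<Rightarrow> real) \<Rightarrow> nat \<Rightarrow> real" where
  "p_hat p0 q t = q t / p0 t"

definition p_tilde :: "real \<Rightarrow> real \<Rightarrow> (nat \<Rightarrow> real) \<Rightarrow> (nat \<Rightarrow> real) \<Rightarrow> nat \<Rightarrow> real" where
  "p_tilde \<epsilon> \<rho> p0 q t =
     (if \<rho> < 0 then p_hat p0 q t powr (- \<rho>) else 1 / \<epsilon> - p_hat p0 q t powr (- \<rho>))"

(* The function (q1^(-rho) x1^(-rho) + q2^(-rho) x2^(-rho))^(-1/rho).
   For rho > 0 it takes its intended values only where x1, x2 > 0, because 0 powr a = 0. *)
definition ces :: "real \<Rightarrow> real \<Rightarrow> real \<Rightarrow> real \<Rightarrow> real \<Rightarrow> real" where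
  "ces \<rho> q1 q2 x1 x2 =
     (q1 powr (- \<rho>) * x1 powr (- \<rho>) + q2 powr (- \<rho>) * x2 powr (- \<rho>)) powr (- 1 / \<rho>)"

(* The requirements on epsilon in the case rho > 0. The last one is restricted to x1, x2 > 0:
   if x1 = 0 or x2 = 0 then x1^(-rho) + x2^(-rho) is infinite, whereas 0 powr (- rho) = 0. *)
definition admissible_eps ::
    "nat \<Rightarrow> real \<Rightarrow> (nat \<Rightarrow> real) \<Rightarrow> (nat \<Rightarrow> real) \<Rightarrow> (nat \<Rightarrow> real) \<Rightarrow> real \<Rightarrow> bool" where
  "admissible_eps T \<rho> p0 p1 p2 \<epsilon> \<longleftrightarrow>
     0 < \<epsilon> \<and>
     (\<forall>t\<in>{1..T}. p_hat p0 p1 t powr (- \<rho>) < 1 / \<epsilon> \<and> p_hat p0 p2 t powr (- \<rho>) < 1 / \<epsilon>) \<and>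
     (\<forall>x1>0. \<forall>x2>0. x1 powr (- \<rho>) + x2 powr (- \<rho>) \<le> \<epsilon> \<longrightarrow>
        (\<forall>t\<in>{1..T}. 1 < ces \<rho> (p_hat p0 p1 t) (p_hat p0 p2 t) x1 x2))"

definition line :: "(nat \<Rightarrow> real) \<Rightarrow> (nat \<Rightarrow> real) \<Rightarrow> nat \<Rightarrow> (real \<times> real) set" where
  "line a b t = {z. a t * fst z + b t * snd z = 1}"

definition no_three_concurrent :: "nat \<Rightarrow> (nat \<Rightarrow> real) \<Rightarrow> (nat \<Rightarrow> real) \<Rightarrow> bool" where
  "no_three_concurrent T a b \<longleftrightarrow>
     (\<forall>r\<in>{1..T}. \<forall>s\<in>{1..T}. \<forall>t\<in>{1..T}. r \<noteq> s \<and> s \<noteq> t \<and> r \<noteq> t \<longrightarrow>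
        line a b r \<inter> line a b s \<inter> line a b t \<inter> nonneg_quadrant = {})"

definition crossing_points :: "nat \<Rightarrow> (nat \<Rightarrow> real) \<Rightarrow> (nat \<Rightarrow> real) \<Rightarrow> (real \<times> real) set" where
  "crossing_points T a b =
     {z. \<exists>s\<in>{1..T}. \<exists>t\<in>{1..T}. s \<noteq> t \<and> z \<in> line a b s \<inter> line a b t}"

definition ray :: "real \<Rightarrow> (real \<times> real) set" where
  "ray \<alpha> = {z \<in> nonneg_quadrant. snd z = fst z * tan \<alpha>}"

definition rays_meet_at_most_one_crossing :: "nat \<Rightarrow> (nat \<Rightarrow> real) \<Rightarrow> (nat \<Rightarrow> real) \<Rightarrow> bool" where
  "rays_meet_at_most_one_crossing T a b \<longleftrightarrow>
     (\<forall>\<alpha>\<in>{0<..<pi / 2}. \<forall>z\<in>ray \<alpha> \<inter> crossing_points T a b.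
        \<forall>w\<in>ray \<alpha> \<inter> crossing_points T a b. z = w)"

definition xi :: "nat \<Rightarrow> nat \<Rightarrow> real \<times> real" where
  "xi T j = (real j - real (T div 2), 1)"

definition snake_vertex :: "nat \<Rightarrow> (nat \<Rightarrow> nat) \<Rightarrow> nat \<Rightarrow> real \<times> real" where
  "snake_vertex T \<sigma> k = (\<Sum>i=k..T. xi T (\<sigma> i))"

definition snake :: "nat \<Rightarrow> (nat \<Rightarrow> nat) \<Rightarrow> (real \<times> real) set" where
  "snake T \<sigma> = (\<Union>k\<in>{1..T}. closed_segment (snake_vertex T \<sigma> k) (snake_vertex T \<sigma> (k + 1)))"

definition region_between :: "(real \<times> real) set \<Rightarrow> (real \<times> real) set \<Rightarrow> (real \<times> real) set" where
  "region_between A B = A \<union> B \<union> \<Union>{C \<in> components (- (A \<union> B)). bounded C}"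

(* Absolute continuity makes the boundary of the quadrant negligible, so the values of ces there
   play no role. Integrability is explicit since the integral of a non-integrable function is 0. *)
definition moment_solution ::
    "nat \<Rightarrow> real \<Rightarrow> (nat \<Rightarrow> real) \<Rightarrow> (nat \<Rightarrow> real) \<Rightarrow> (nat \<Rightarrow> real) \<Rightarrow> (nat \<Rightarrow> real) \<Rightarrow>
     (real \<times> real) measure \<Rightarrow> bool" where
  "moment_solution T \<rho> p0 p1 p2 y \<mu> \<longleftrightarrow>
     sets \<mu> = sets borel \<and> absolutely_continuous lborel \<mu> \<and>
     (\<forall>t\<in>{1..T}.
        set_integrable \<mu> nonneg_quadrant
          (\<lambda>x. theta (p0 t - ces \<rho> (p1 t) (p2 t) (fst x) (snd x))) \<and>
        (LINT x:nonneg_quadrant|\<mu>. theta (p0 t - ces \<rho> (p1 t) (p2 t) (fst x) (snd x))) = y t)"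

end

theory Submission
  imports Defs
begin

text \<open>
  If \<open>p_tilde\<close> increases from \<open>i\<close> to \<open>j\<close> in both coordinates, then the sublevel set belonging to
  \<open>j\<close> is contained in the one belonging to \<open>i\<close>, so \<open>y j \<le> y i\<close> for any solution. Hence
  \<open>\<lambda>\<close> can only invert pairs that \<open>\<Sigma>\<^sub>\<rho>\<close> inverts, i.e. \<open>\<lambda>\<close> lies below \<open>\<Sigma>\<^sub>\<rho>\<close> in the weak order
  of permutations. This bounds each tail sum of \<open>\<lambda>\<close> by those of \<open>\<Sigma>\<^sub>\<rho>\<close> and of the identity.
  Each snake is the graph of its abscissa as a function of the height, so the snake of \<open>\<lambda>\<close> runs
  between the other two.
\<close>

section \<open>Sublevel sets and monotonicity of the moments\<close>

text \<open>Dividing by \<open>p0\<close> turns both conditions into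
  \<open>N t powr (- 1 / \<rho>) \<le> 1\<close>. For negative \<open>\<rho>\<close>,
  \<open>N\<close> grows with \<open>p_tilde\<close> and the outer exponent is positive; for
  positive \<open>\<rho>\<close> both monotonicities reverse. Either way the left-hand side at
  \<open>i\<close> is at most the one at \<open>j\<close>.\<close>

lemma sublevel_sets_nested:
  assumes rho: "\<rho> \<in> {-1..<0} \<union> {0<..}"
    and pos: "0 < p0 i" "0 < p0 j" "0 < p1 i" "0 < p1 j" "0 < p2 i" "0 < p2 j"
    and le1: "p_tilde \<epsilon> \<rho> p0 p1 i \<le> p_tilde \<epsilon> \<rho> p0 p1 j"
    and le2: "p_tilde \<epsilon> \<rho> p0 p2 i \<le> p_tilde \<epsilon> \<rho> p0 p2 j"
    and ces: "ces \<rho> (p1 j) (p2 j) x1 x2 \<le> p0 j"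
  shows "ces \<rho> (p1 i) (p2 i) x1 x2 \<le> p0 i"
proof -
  define S where "S t = p1 t powr (-\<rho>) * x1 powr (-\<rho>) + p2 t powr (-\<rho>) * x2 powr (-\<rho>)" for t
  define N where "N t = p_hat p0 p1 t powr (-\<rho>) * x1 powr (-\<rho>) + p_hat p0 p2 t powr (-\<rho>) * x2 powr (-\<rho>)" for t
  have S: "S t = p0 t powr (-\<rho>) * N t" if "t \<in> {i, j}" for t
    using that pos by (auto simp: S_def N_def p_hat_def powr_divide field_simps)
  have N0: "0 \<le> N t" for t
    by (simp add: N_def)
  have ces_eq: "ces \<rho> (p1 t) (p2 t) x1 x2 = p0 t * N t powr (- 1 / \<rho>)" if "t \<in> {i, j}" for t
  proof -
    have "ces \<rho> (p1 t) (p2 t) x1 x2 = S t powr (- 1 / \<rho>)"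
      by (simp add: ces_def S_def)
    also have "\<dots> = (p0 t powr (-\<rho>)) powr (- 1 / \<rho>) * N t powr (- 1 / \<rho>)"
      using S[OF that] N0[of t] by (simp add: powr_mult)
    also have "(p0 t powr (-\<rho>)) powr (- 1 / \<rho>) = p0 t"
      using that pos rho by (auto simp: powr_powr)
    finally show ?thesis .
  qed
  have Nj: "N j powr (- 1 / \<rho>) \<le> 1"
    using ces ces_eq[of j] pos by simp
  have "N i powr (- 1 / \<rho>) \<le> N j powr (- 1 / \<rho>) \<or> N i powr (- 1 / \<rho>) \<le> 1"
  proof (cases "\<rho> < 0")
    case True
    then have "N i \<le> N j"
      using le1 le2 unfolding N_def p_tilde_def by (intro add_mono mult_right_mono) auto
    then show ?thesis
      using True N0[of i] by (auto intro!: powr_mono2 simp: divide_nonpos_neg)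
  next
    case False
    with rho have \<rho>: "\<rho> > 0" by auto
    have "N j \<le> N i"
      using le1 le2 \<rho> unfolding N_def p_tilde_def by (intro add_mono mult_right_mono) auto
    show ?thesis
    proof (cases "N j = 0")
      case True
      \<comment> \<open>Since \<open>0 powr a = 0\<close>, \<open>N j\<close> vanishes at the origin, but so does \<open>N i\<close>.\<close>
      have "x1 = 0" "x2 = 0"
        using True pos unfolding N_def p_hat_def
        by (auto simp: add_nonneg_eq_0_iff)
      then show ?thesis
        by (simp add: N_def)
    next
      case False
      then have "0 < N j" using N0[of j] by simp
      then show ?thesis
        using \<open>N j \<le> N i\<close> \<rho> by (auto intro!: powr_mono2')
    qed
  qed
  then have "N i powr (- 1 / \<rho>) \<le> 1" using Nj by linarith
  then show ?thesis
    using ces_eq[of i] pos by simp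
qed

lemma moment_solution_antimono:
  assumes sol: "moment_solution T \<rho> p0 p1 p2 y \<mu>"
    and ij: "i \<in> {1..T}" "j \<in> {1..T}"
    and rho: "\<rho> \<in> {-1..<0} \<union> {0<..}"
    and p0: "\<And>t. t \<in> {1..T} \<Longrightarrow> p0 t > 0"
    and p: "\<And>t. t \<in> {1..T} \<Longrightarrow> p1 t > 0 \<and> p2 t > 0"
    and le: "p_tilde \<epsilon> \<rho> p0 p1 i \<le> p_tilde \<epsilon> \<rho> p0 p1 j"
      "p_tilde \<epsilon> \<rho> p0 p2 i \<le> p_tilde \<epsilon> \<rho> p0 p2 j"
  shows "y j \<le> y i"
proof -
  let ?f = "\<lambda>t x. theta (p0 t - ces \<rho> (p1 t) (p2 t) (fst x) (snd x))"
  have "(LINT x:nonneg_quadrant|\<mu>. ?f j x) \<le> (LINT x:nonneg_quadrant|\<mu>. ?f i x)"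
  proof (rule set_integral_mono)
    show "set_integrable \<mu> nonneg_quadrant (?f j)" "set_integrable \<mu> nonneg_quadrant (?f i)"
      using sol ij by (auto simp: moment_solution_def)
    show "?f j x \<le> ?f i x" for x
      using sublevel_sets_nested[OF rho _ _ _ _ _ _ le, of "fst x" "snd x"] p0 p ij
      by (auto simp: theta_def)
  qed
  then show ?thesis
    using sol ij by (simp add: moment_solution_def)
qed

section \<open>Tail sums of permutations under the weak order\<close>

text \<open>The two set differences have equal cardinality, and any bijection from
  \<open>B - A\<close> to \<open>A - B\<close> can only raise \<open>c\<close>; the common part
  contributes equally to both sums.\<close>

lemma sum_le_of_separated:
  fixes c :: "'a \<Rightarrow> 'b::linordered_idom"
  assumes fin: "finite A" "finite B" and card: "card A = card B"
    and sep: "\<And>a b. a \<in> A - B \<Longrightarrow> b \<in> B - A \<Longrightarrow> c b \<le> c a"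
  shows "sum c B \<le> sum c A"
proof -
  have "card (A - B) = card (B - A)"
    using fin card by (simp add: card_Diff_subset_Int Int_commute)
  then obtain h where h: "bij_betw h (B - A) (A - B)"
    using fin finite_same_card_bij[of "B - A" "A - B"] by auto
  have "sum c (B - A) \<le> (\<Sum>b\<in>B - A. c (h b))"
    using h by (intro sum_mono sep) (auto simp: bij_betw_def)
  also have "\<dots> = sum c (A - B)"
    by (rule sum.reindex_bij_betw[OF h])
  finally have "sum c (B - A) + sum c (A \<inter> B) \<le> sum c (A - B) + sum c (A \<inter> B)"
    by simp
  moreover have "sum c B = sum c (B - A) + sum c (A \<inter> B)"
    using fin sum.Int_Diff[of B c A] by (simp add: Int_commute)
  moreover have "sum c A = sum c (A - B) + sum c (A \<inter> B)"
    using fin sum.Int_Diff[of A c B] by simp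
  ultimately show ?thesis by simp
qed

text \<open>The hypothesis \<open>inv\<close> says that whenever \<open>\<sigma>\<close> and
  \<open>\<tau>\<close> order two values oppositely, the value coming later in
  \<open>\<sigma>\<close> is the larger. A value found only in the tail of \<open>\<sigma>\<close>
  and one found only in the tail of \<open>\<tau>\<close> form such a pair, so the tails are
  separated.\<close>

lemma tail_sum_le_of_weak_order:
  fixes c :: "nat \<Rightarrow> 'b::linordered_idom"
  assumes \<sigma>: "\<sigma> permutes {1..T}" and \<tau>: "\<tau> permutes {1..T}"
    and c: "mono_on {1..T} c"
    and inv: "\<And>s t s' t'. \<lbrakk>s \<in> {1..T}; t \<in> {1..T}; s' \<in> {1..T}; t' \<in> {1..T}; s < t; s' < t';
        \<sigma> t = \<tau> s'; \<sigma> s = \<tau> t'\<rbrakk> \<Longrightarrow> \<tau> t' \<le> \<tau> s'"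
    and k: "1 \<le> k"
  shows "(\<Sum>i=k..T. c (\<tau> i)) \<le> (\<Sum>i=k..T. c (\<sigma> i))"
proof -
  have inj: "inj_on \<sigma> {k..T}" "inj_on \<tau> {k..T}"
    using permutes_inj[OF \<sigma>] permutes_inj[OF \<tau>] by (auto intro: inj_on_subset)
  have "sum c (\<tau> ` {k..T}) \<le> sum c (\<sigma> ` {k..T})"
  proof (rule sum_le_of_separated)
    fix a b
    assume a: "a \<in> \<sigma> ` {k..T} - \<tau> ` {k..T}" and b: "b \<in> \<tau> ` {k..T} - \<sigma> ` {k..T}"
    obtain t where t: "t \<in> {k..T}" "a = \<sigma> t" using a by auto
    obtain t' where t': "t' \<in> {k..T}" "b = \<tau> t'" using b by auto
    have ab: "a \<in> {1..T}" "b \<in> {1..T}"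
      using t t' k permutes_in_image[OF \<sigma>, of t] permutes_in_image[OF \<tau>, of t'] by auto
    obtain s' where s': "s' \<in> {1..T}" "a = \<tau> s'"
      using ab permutes_image[OF \<tau>] by (metis imageE)
    obtain s where s: "s \<in> {1..T}" "b = \<sigma> s"
      using ab permutes_image[OF \<sigma>] by (metis imageE)
    \<comment> \<open>Each value sits before position \<open>k\<close> in the permutation whose tail
      omits it: \<open>\<sigma>\<close> puts \<open>b\<close> before \<open>a\<close>, and
      \<open>\<tau>\<close> puts \<open>a\<close> before \<open>b\<close>.\<close>
    have "s' < k" using a s' by (force simp: not_less)
    moreover have "s < k" using b s by (force simp: not_less)
    ultimately have "b \<le> a"
      using inv[of s t s' t'] s s' t t' k by auto
    then show "c b \<le> c a"
      using c ab by (auto simp: mono_on_def)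
  qed (use inj in \<open>auto simp: card_image\<close>)
  then show ?thesis
    using inj by (simp add: sum.reindex)
qed

section \<open>Snakes as graphs over the height\<close>

text \<open>The clamped factor is the fraction of edge \<open>i\<close>, which spans heights
  \<open>T - i\<close> to \<open>T - i + 1\<close>, lying below height \<open>h\<close>. Clamping
  also extends the abscissa continuously to all real heights.\<close>

definition snake_graph :: "nat \<Rightarrow> (nat \<Rightarrow> nat) \<Rightarrow> real \<Rightarrow> real" where
  "snake_graph T \<sigma> h =
     (\<Sum>i=1..T. (real (\<sigma> i) - real (T div 2)) * min 1 (max 0 (h - (real T - real i))))"

lemma continuous_on_snake_graph: "continuous_on UNIV (snake_graph T \<sigma>)"
  unfolding snake_graph_def by (intro continuous_intros)

lemma snake_vertex_eq:
  assumes "k \<le> T + 1"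
  shows "snake_vertex T \<sigma> k
    = (\<Sum>i=k..T. real (\<sigma> i) - real (T div 2), real T + 1 - real k)"
  using assms by (simp add: snake_vertex_def xi_def prod_eq_iff fst_sum snd_sum of_nat_diff)

text \<open>At this height the edges after \<open>k\<close> are complete, those before
  \<open>k\<close> have not begun, and edge \<open>k\<close> contributes the fraction
  \<open>1 - u\<close>.\<close>

lemma snake_graph_convex_combination:
  assumes k: "k \<in> {1..T}" and u: "0 \<le> u" "u \<le> 1"
  shows "snake_graph T \<sigma> (real T + 1 - real k - u)
    = (1 - u) * fst (snake_vertex T \<sigma> k) + u * fst (snake_vertex T \<sigma> (k + 1))"
proof -
  let ?c = "\<lambda>i. real (\<sigma> i) - real (T div 2)"
  let ?w = "\<lambda>i. min 1 (max 0 (real T + 1 - real k - u - (real T - real i)))"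
  have split: "{1..T} = {1..<k} \<union> ({k} \<union> {k+1..T})" using k by auto
  have "snake_graph T \<sigma> (real T + 1 - real k - u)
    = (\<Sum>i\<in>{1..<k}. ?c i * ?w i) + (?c k * ?w k + (\<Sum>i=k+1..T. ?c i * ?w i))"
    unfolding snake_graph_def split by (subst sum.union_disjoint; auto)+
  also have "(\<Sum>i\<in>{1..<k}. ?c i * ?w i) = 0"
    using u by (intro sum.neutral) auto
  also have "(\<Sum>i=k+1..T. ?c i * ?w i) = (\<Sum>i=k+1..T. ?c i)"
    using u by (intro sum.cong) auto
  also have "?w k = 1 - u" using u by auto
  finally have *: "snake_graph T \<sigma> (real T + 1 - real k - u) = ?c k * (1 - u) + (\<Sum>i=k+1..T. ?c i)"
    by simp
  have "(\<Sum>i=k..T. ?c i) = ?c k + (\<Sum>i=k+1..T. ?c i)"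
    using k by (simp add: sum.atLeast_Suc_atMost)
  then have "fst (snake_vertex T \<sigma> k) = ?c k + (\<Sum>i=k+1..T. ?c i)"
    using k snake_vertex_eq[of k T \<sigma>] by simp
  moreover have "fst (snake_vertex T \<sigma> (k + 1)) = (\<Sum>i=k+1..T. ?c i)"
    using k snake_vertex_eq[of "k + 1" T \<sigma>] by simp
  ultimately show ?thesis unfolding * by (simp only:) (simp add: algebra_simps)
qed

lemma snake_height_cases:
  assumes "1 \<le> T" "h \<in> {0..real T}"
  obtains k u where "k \<in> {1..T}" "0 \<le> u" "u \<le> 1" "h = real T + 1 - real k - u"
\<comment> \<open>The ceiling of 0 would give \<open>k = T + 1\<close>, beyond the last edge, so
  height 0 is taken as the lower end of edge \<open>T\<close>.\<close>
proof (cases "h = 0")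
  case True
  then show ?thesis using that[of T 1] assms by simp
next
  case False
  define n where "n = nat \<lceil>h\<rceil>"
  have "real n = of_int \<lceil>h\<rceil>" using assms by (simp add: n_def)
  then have n: "h \<le> real n" "real n < h + 1" by linarith+
  then have "1 \<le> n" "n \<le> T" using False assms by auto
  show ?thesis
  proof (rule that)
    show "T + 1 - n \<in> {1..T}" using \<open>1 \<le> n\<close> \<open>n \<le> T\<close> by auto
    show "h = real T + 1 - real (T + 1 - n) - (real n - h)"
      using \<open>n \<le> T\<close> by (simp add: of_nat_diff)
  qed (use n in auto)
qed

text \<open>Every \<open>xi\<close> has second coordinate 1, so each edge spans exactly one unit of
  height.\<close>

lemma snake_eq_graph:
  assumes "1 \<le> T"
  shows "snake T \<sigma> = (\<lambda>h. (snake_graph T \<sigma> h, h)) ` {0..real T}"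
proof -
  have pt: "(1 - u) *\<^sub>R snake_vertex T \<sigma> k + u *\<^sub>R snake_vertex T \<sigma> (k + 1)
      = (snake_graph T \<sigma> (real T + 1 - real k - u), real T + 1 - real k - u)"
    if "k \<in> {1..T}" "0 \<le> u" "u \<le> 1" for k u
  proof -
    have "snd (snake_vertex T \<sigma> k) = real T + 1 - real k"
      "snd (snake_vertex T \<sigma> (k + 1)) = real T - real k"
      using that snake_vertex_eq[of k T \<sigma>] snake_vertex_eq[of "k + 1" T \<sigma>] by auto
    then show ?thesis
      unfolding snake_graph_convex_combination[OF that] by (simp add: prod_eq_iff) (simp add: algebra_simps)
  qed
  show ?thesis
  proof (intro equalityI subsetI)
    fix z assume "z \<in> snake T \<sigma>"
    then obtain k u where ku: "k \<in> {1..T}" "0 \<le> u" "u \<le> 1"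
      and z: "z = (1 - u) *\<^sub>R snake_vertex T \<sigma> k + u *\<^sub>R snake_vertex T \<sigma> (k + 1)"
      by (auto simp: snake_def in_segment)
    show "z \<in> (\<lambda>h. (snake_graph T \<sigma> h, h)) ` {0..real T}"
      unfolding z pt[OF ku] using ku by (intro imageI) auto
  next
    fix z assume "z \<in> (\<lambda>h. (snake_graph T \<sigma> h, h)) ` {0..real T}"
    then obtain h where h: "h \<in> {0..real T}" "z = (snake_graph T \<sigma> h, h)" by auto
    from assms h(1) obtain k u where ku: "k \<in> {1..T}" "0 \<le> u" "u \<le> 1"
      "h = real T + 1 - real k - u" by (rule snake_height_cases)
    then have "z \<in> closed_segment (snake_vertex T \<sigma> k) (snake_vertex T \<sigma> (k + 1))"
      using pt[OF ku(1-3)] h by (auto simp: in_segment intro!: exI[of _ u])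
    then show "z \<in> snake T \<sigma>" using ku by (auto simp: snake_def)
  qed
qed

text \<open>Vertices of equal index have equal height in both snakes, and both graphs are affine in
  between; comparing abscissas at vertices, which are the tail sums, suffices.\<close>

lemma snake_graph_mono:
  assumes "1 \<le> T" "h \<in> {0..real T}"
    and le: "\<And>k. 1 \<le> k \<Longrightarrow> (\<Sum>i=k..T. real (\<tau> i) - real (T div 2))
      \<le> (\<Sum>i=k..T. real (\<sigma> i) - real (T div 2))"
  shows "snake_graph T \<tau> h \<le> snake_graph T \<sigma> h"
proof -
  from assms(1,2) obtain k u where ku: "k \<in> {1..T}" "0 \<le> u" "u \<le> 1"
    "h = real T + 1 - real k - u" by (rule snake_height_cases)
  have "fst (snake_vertex T \<tau> m) \<le> fst (snake_vertex T \<sigma> m)" if "m \<in> {k, k + 1}" for m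
    using that ku(1) le[of m] snake_vertex_eq[of m T] by auto
  then show ?thesis
    unfolding ku(4) snake_graph_convex_combination[OF ku(1-3)]
    using ku(2,3) by (intro add_mono mult_left_mono) auto
qed

text \<open>Together with \<open>snake_graph_ge_T\<close>, this makes the extended graphs of all
  permutations agree outside heights 0 to \<open>T\<close>.\<close>

lemma snake_graph_le_0: "h \<le> 0 \<Longrightarrow> snake_graph T \<sigma> h = 0"
  unfolding snake_graph_def by (intro sum.neutral) auto

lemma snake_graph_ge_T:
  assumes "\<sigma> permutes {1..T}" "real T \<le> h"
  shows "snake_graph T \<sigma> h = (\<Sum>i=1..T. real i - real (T div 2))"
proof -
  have "snake_graph T \<sigma> h = (\<Sum>i=1..T. real (\<sigma> i) - real (T div 2))"
    unfolding snake_graph_def using assms by (intro sum.cong) auto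
  also have "\<dots> = (\<Sum>i=1..T. real i - real (T div 2))"
    using sum.permute[OF assms(1), of "\<lambda>i. real i - real (T div 2)"] by (simp add: o_def)
  finally show ?thesis .
qed

section \<open>The region enclosed by two graphs\<close>

text \<open>The open set \<open>R\<close> strictly between the graphs is bounded and its frontier
  lies on them, so a component of the complement that meets \<open>R\<close> stays inside
  \<open>R\<close> and is bounded.\<close>

lemma mem_region_between_graphs:
  fixes f g :: "real \<Rightarrow> real"
  assumes f: "continuous_on UNIV f" and g: "continuous_on UNIV g"
    and eq: "\<And>h. h \<notin> {0..H} \<Longrightarrow> f h = g h"
    and h: "h \<in> {0..H}" and x: "f h \<le> x" "x \<le> g h"
  shows "(x, h) \<in> region_between ((\<lambda>h. (g h, h)) ` {0..H}) ((\<lambda>h. (f h, h)) ` {0..H})"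
    (is "_ \<in> region_between ?A ?B")
proof (cases "x = f h \<or> x = g h")
  case True
  then show ?thesis using h by (auto simp: region_between_def)
next
  case False
  define R where "R = {z. f (snd z) < fst z \<and> fst z < g (snd z)}"
  define K where "K = {z. f (snd z) \<le> fst z \<and> fst z \<le> g (snd z)} \<inter> {z. 0 \<le> snd z \<and> snd z \<le> H}"
  have fs: "continuous_on UNIV (\<lambda>z::real \<times> real. f (snd z))"
    using f by (rule continuous_on_compose2) (auto intro: continuous_intros)
  have gs: "continuous_on UNIV (\<lambda>z::real \<times> real. g (snd z))"
    using g by (rule continuous_on_compose2) (auto intro: continuous_intros)
  have "open R"
    unfolding R_def by (intro open_Collect_conj open_Collect_less fs gs continuous_intros)
  have "closed K"
    unfolding K_def by (intro closed_Int closed_Collect_conj closed_Collect_le fs gs continuous_intros)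
  \<comment> \<open>Outside heights 0 to \<open>H\<close> the graphs coincide, leaving no room for
    strict inequalities.\<close>
  have RK: "R \<subseteq> K"
  proof
    fix z assume z: "z \<in> R"
    then have "snd z \<in> {0..H}" using eq[of "snd z"] by (auto simp: R_def)
    then show "z \<in> K" using z by (auto simp: R_def K_def)
  qed
  have "frontier R \<subseteq> K - R"
    using closure_minimal[OF RK \<open>closed K\<close>] \<open>open R\<close>
    by (auto simp: frontier_def interior_open)
  \<comment> \<open>In \<open>K - R\<close> the weak inequalities hold but a strict one fails, which
    puts the point on a graph.\<close>
  also have "\<dots> \<subseteq> ?A \<union> ?B"
    by (force simp: K_def R_def image_iff prod_eq_iff)
  finally have frontier: "frontier R \<subseteq> ?A \<union> ?B" .
  have "bounded R"
  proof -
    have "compact (f ` {0..H})" "compact (g ` {0..H})"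
      using f g by (auto intro!: compact_continuous_image intro: continuous_on_subset)
    then have "bounded (f ` {0..H} \<union> g ` {0..H})"
      by (simp add: compact_imp_bounded)
    then obtain M where M: "\<And>v. v \<in> f ` {0..H} \<union> g ` {0..H} \<Longrightarrow> \<bar>v\<bar> \<le> M"
      unfolding bounded_real by blast
    have "R \<subseteq> {-M..M} \<times> {0..H}"
    proof
      fix z assume "z \<in> R"
      then have z: "z \<in> K" using RK by auto
      then show "z \<in> {-M..M} \<times> {0..H}"
        using M[of "f (snd z)"] M[of "g (snd z)"] by (auto simp: K_def mem_Times_iff)
    qed
    moreover have "bounded ({-M..M} \<times> {0..H})"
      by (intro bounded_Times) auto
    ultimately show ?thesis using bounded_subset by blast
  qed
  have xR: "(x, h) \<in> R" using False x by (auto simp: R_def)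
  have notAB: "(x, h) \<in> - (?A \<union> ?B)" using False by auto
  define C where "C = connected_component_set (- (?A \<union> ?B)) (x, h)"
  have xC: "(x, h) \<in> C" using notAB by (simp add: C_def)
  have "C \<subseteq> - (?A \<union> ?B)" unfolding C_def by (rule connected_component_subset)
  then have "C \<inter> frontier R = {}" using frontier by blast
  moreover have "connected C" by (simp add: C_def)
  ultimately have "C \<subseteq> R"
    using connected_Int_frontier[of C R] xC xR by blast
  then have "bounded C" using \<open>bounded R\<close> bounded_subset by blast
  moreover have "C \<in> components (- (?A \<union> ?B))"
    using notAB by (auto simp: C_def components_def)
  ultimately show ?thesis
    using xC unfolding region_between_def by blast
qed

section \<open>Solvability confines the snake to the region\<close>

theorem proposition6p4:
  fixes T :: nat
    and \<rho> \<epsilon> :: real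
    and y p0 p1 p2 :: "nat \<Rightarrow> real"
    and lam Sig :: "nat \<Rightarrow> nat"
  assumes T: "T \<ge> 1"
    and rho: "\<rho> \<in> {-1..<0} \<union> {0<..}"
    and y: "\<And>t. t \<in> {1..T} \<Longrightarrow> y t \<ge> 0"
    and p0: "\<And>t. t \<in> {1..T} \<Longrightarrow> p0 t > 0"
    and p: "\<And>t. t \<in> {1..T} \<Longrightarrow> p1 t > 0 \<and> p2 t > 0"
    and eps: "\<rho> > 0 \<Longrightarrow> admissible_eps T \<rho> p0 p1 p2 \<epsilon>"
    and numbering: "\<And>s t. 1 \<le> s \<Longrightarrow> s < t \<Longrightarrow> t \<le> T \<Longrightarrow>
           p_tilde \<epsilon> \<rho> p0 p1 s < p_tilde \<epsilon> \<rho> p0 p1 t"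
    and Sig_perm: "Sig permutes {1..T}"
    and Sig: "\<And>s t. 1 \<le> s \<Longrightarrow> s < t \<Longrightarrow> t \<le> T \<Longrightarrow>
           p_tilde \<epsilon> \<rho> p0 p2 (Sig s) < p_tilde \<epsilon> \<rho> p0 p2 (Sig t)"
    and no_three: "no_three_concurrent T (p_tilde \<epsilon> \<rho> p0 p1) (p_tilde \<epsilon> \<rho> p0 p2)"
    and rays: "rays_meet_at_most_one_crossing T (p_tilde \<epsilon> \<rho> p0 p1) (p_tilde \<epsilon> \<rho> p0 p2)"
    and lam_perm: "lam permutes {1..T}"
    and lam: "\<And>s t. 1 \<le> s \<Longrightarrow> s < t \<Longrightarrow> t \<le> T \<Longrightarrow> y (lam t) < y (lam s)"
    and outside: "\<not> snake T lam \<subseteq> region_between (snake T id) (snake T Sig)"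
  shows "\<nexists>\<mu> :: (real \<times> real) measure. moment_solution T \<rho> p0 p1 p2 y \<mu>"
proof
  assume "\<exists>\<mu> :: (real \<times> real) measure. moment_solution T \<rho> p0 p1 p2 y \<mu>"
  then obtain \<mu> :: "(real \<times> real) measure" where sol: "moment_solution T \<rho> p0 p1 p2 y \<mu>" ..
  have in_T: "lam t \<in> {1..T}" "Sig t \<in> {1..T}" if "t \<in> {1..T}" for t
    using that permutes_in_image[OF lam_perm] permutes_in_image[OF Sig_perm] by auto
  let ?c = "\<lambda>j. real j - real (T div 2)"
  have c: "mono_on {1..T} ?c" by (auto simp: mono_on_def)
  have Sig_le_lam: "(\<Sum>i=k..T. ?c (Sig i)) \<le> (\<Sum>i=k..T. ?c (lam i))" if "1 \<le> k" for k
  proof (rule tail_sum_le_of_weak_order[OF lam_perm Sig_perm c _ that])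
    fix s t s' t'
    assume st: "s \<in> {1..T}" "t \<in> {1..T}" "s' \<in> {1..T}" "t' \<in> {1..T}" "s < t" "s' < t'"
      "lam t = Sig s'" "lam s = Sig t'"
    show "Sig t' \<le> Sig s'"
    proof (rule ccontr)
      assume "\<not> Sig t' \<le> Sig s'"
      then have less: "Sig s' < Sig t'" by simp
      \<comment> \<open>The first coordinate increases from \<open>Sig s'\<close> to
        \<open>Sig t'\<close> because the values do, the second because the positions do. The
        resulting inequality reads \<open>y (lam s) \<le> y (lam t)\<close>, against
        \<open>s < t\<close>.\<close>
      have "y (Sig t') \<le> y (Sig s')"
      proof (rule moment_solution_antimono[OF sol _ _ rho p0 p])
        show "p_tilde \<epsilon> \<rho> p0 p1 (Sig s') \<le> p_tilde \<epsilon> \<rho> p0 p1 (Sig t')"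
          using numbering[OF _ less] in_T(2)[OF st(3)] in_T(2)[OF st(4)] by simp
        show "p_tilde \<epsilon> \<rho> p0 p2 (Sig s') \<le> p_tilde \<epsilon> \<rho> p0 p2 (Sig t')"
          using Sig[of s' t'] st by simp
      qed (use in_T st in auto)
      moreover have "y (lam t) < y (lam s)" using lam[of s t] st by simp
      ultimately show False using st by simp
    qed
  qed
  \<comment> \<open>With the identity as \<open>\<sigma>\<close>, position and value agree, so the
    later value is the larger one automatically.\<close>
  have lam_le_id: "(\<Sum>i=k..T. ?c (lam i)) \<le> (\<Sum>i=k..T. ?c (id i))" if "1 \<le> k" for k
    by (rule tail_sum_le_of_weak_order[OF permutes_id lam_perm c _ that]) auto
  have "snake T lam \<subseteq> region_between (snake T id) (snake T Sig)"
  proof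
    fix z assume "z \<in> snake T lam"
    then obtain h where h: "h \<in> {0..real T}" and z: "z = (snake_graph T lam h, h)"
      using snake_eq_graph[OF T] by auto
    show "z \<in> region_between (snake T id) (snake T Sig)"
      unfolding z snake_eq_graph[OF T, of id] snake_eq_graph[OF T, of Sig]
    proof (rule mem_region_between_graphs[OF continuous_on_snake_graph continuous_on_snake_graph _ h])
      show "snake_graph T Sig h' = snake_graph T id h'" if "h' \<notin> {0..real T}" for h'
        using that snake_graph_le_0[of h' T] snake_graph_ge_T[OF Sig_perm, of h']
          snake_graph_ge_T[OF permutes_id, of T h'] by force
      show "snake_graph T Sig h \<le> snake_graph T lam h"
        using Sig_le_lam by (intro snake_graph_mono T h)
      show "snake_graph T lam h \<le> snake_graph T id h"
        using lam_le_id by (intro snake_graph_mono T h)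
    qed
  qed
  with outside show False ..
qed

end
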